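(* Let $X$ be a digital image, and assume that there is some dimension $k$ for which $X$ contains no simplices of dimension greater than $k$. Then for each $q \ge 0$ we have $H_q(X) \cong \check{H}_q(X)$, where $H_q(X)$ is the simplicial homology group and $\check H_q(X)$ is the singular homology group of $X$.
   Context: A digital image is a set $X$ with a symmetric, antireflexive adjacency relation. A function between digital images is continuous if it sends adjacent points to points that are adjacent or equal. Simplicial homology. A $q$-simplex in $X$ (a simplex of dimension $q$) is a set of $q+1$ distinct mutually adjacent points; an ordered $q$-simplex is a listing $\langle x_0,\dots,x_q\rangle$ of such points. $C_q(X)$ is the abelian group generated by all ordered $q$-simplices subject to $\langle x_0,\dots,x_q\rangle = (-1)^\rho\langle x_{\rho(0)},\dots,x_{\rho(q)}\rangle$ for every permutation $\rho$ of $\{0,\dots,q\}$, where $(-1)^\rho$ is the sign of $\rho$. The boundary is $\partial_q\langle x_0,\dots,x_q\rangle = \sum_{i=0}^q (-1)^i\langle x_0,\dots,\widehat{x_i},\dots,x_q\rangle$ (with $\partial_0=0$). $H_q(X)$ is the $q$-th homology group of the chain complex $(C_q(X),\partial_q)$. Singular homology. Let $\Delta^q=(e_0,\dots,e_q)$ be the digital image of $q+1$ mutually adjacent points. A singular $q$-simplex in $X$ is a continuous function $\phi:\Delta^q\to X$, written $[\phi(e_0),\dots,\phi(e_q)]$ (so it is a list of $q+1$ points, repetitions allowed, any two of which are adjacent or equal). $\check C_q(X)$ is the free abelian group on all singular $q$-simplices, with boundary $\partial_q[x_0,\dots,x_q]=\sum_{i=0}^q(-1)^i[x_0,\dots,\widehat{x_i},\dots,x_q]$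 (with $\partial_0=0$). $\check H_q(X)$ is the $q$-th homology group of $(\check C_q(X),\partial_q)$. *)

theory Defs
  imports "HOL-Algebra.Free_Abelian_Groups" "HOL-Combinatorics.Permutations"
begin

section \<open>Digital images\<close>

definition digital_image :: "'a set \<Rightarrow> ('a \<Rightarrow> 'a \<Rightarrow> bool) \<Rightarrow> bool" where
  "digital_image X adj \<longleftrightarrow> symp_on X adj \<and> irreflp_on X adj"

definition digital_continuous ::
    "'a set \<Rightarrow> ('a \<Rightarrow> 'a \<Rightarrow> bool) \<Rightarrow> 'b set \<Rightarrow> ('b \<Rightarrow> 'b \<Rightarrow> bool) \<Rightarrow> ('a \<Rightarrow> 'b) \<Rightarrow> bool" where
  "digital_continuous X adj\<^sub>X Y adj\<^sub>Y f \<longleftrightarrow>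
     f \<in> X \<rightarrow> Y \<and> (\<forall>x\<in>X. \<forall>x'\<in>X. adj\<^sub>X x x' \<longrightarrow> adj\<^sub>Y (f x) (f x') \<or> f x = f x')"

section \<open>Homology and the alternating face sum\<close>

text \<open>The homology at \<open>G\<close> of a pair of homomorphisms \<open>d' : G' \<rightarrow> G\<close> and \<open>d : G \<rightarrow> G''\<close>:
  the kernel of \<open>d\<close> modulo the image of \<open>d'\<close>.\<close>

definition homology_at ::
    "'c monoid \<Rightarrow> ('c \<Rightarrow> 'b) \<Rightarrow> 'b monoid \<Rightarrow> ('b \<Rightarrow> 'd) \<Rightarrow> 'd monoid \<Rightarrow> 'b set monoid" where
  "homology_at G' d' G d G'' = G\<lparr>carrier := kernel G G'' d\<rparr> Mod (d' ` carrier G')"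

text \<open>Formal \<open>\<int>\<close>-linear combinations are elements of \<open>_ \<Rightarrow>\<^sub>0 int\<close>, as in
  \<^const>\<open>free_Abelian_group\<close>. In degree 0 the boundary is the zero map. Below, its codomain
  in degree 0 is formally the chain group in degree \<open>0 - 1 = 0\<close>; the kernel of the zero map
  does not depend on this choice.\<close>

definition list_face :: "nat \<Rightarrow> 'a list \<Rightarrow> 'a list" where
  "list_face i xs = take i xs @ drop (Suc i) xs"

definition list_boundary :: "nat \<Rightarrow> ('a list \<Rightarrow>\<^sub>0 int) \<Rightarrow> ('a list \<Rightarrow>\<^sub>0 int)" where
  "list_boundary q c =
     (if q = 0 then 0
      else frag_extend (\<lambda>xs. \<Sum>i\<le>q. frag_cmul ((-1) ^ i) (frag_of (list_face i xs))) c)"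

section \<open>Simplicial homology\<close>

definition simplex :: "nat \<Rightarrow> 'a set \<Rightarrow> ('a \<Rightarrow> 'a \<Rightarrow> bool) \<Rightarrow> 'a set \<Rightarrow> bool" where
  "simplex q X adj S \<longleftrightarrow> S \<subseteq> X \<and> card S = Suc q \<and> pairwise adj S"

definition ordered_simplices :: "nat \<Rightarrow> 'a set \<Rightarrow> ('a \<Rightarrow> 'a \<Rightarrow> bool) \<Rightarrow> 'a list set" where
  "ordered_simplices q X adj = {xs. length xs = Suc q \<and> distinct xs \<and> simplex q X adj (set xs)}"

definition orientation_relations ::
    "nat \<Rightarrow> 'a set \<Rightarrow> ('a \<Rightarrow> 'a \<Rightarrow> bool) \<Rightarrow> ('a list \<Rightarrow>\<^sub>0 int) set" where
  "orientation_relations q X adj =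
     generate (free_Abelian_group (ordered_simplices q X adj))
       {frag_of xs - frag_cmul (sign \<rho>) (frag_of (permute_list \<rho> xs)) | xs \<rho>.
          xs \<in> ordered_simplices q X adj \<and> \<rho> permutes {..q}}"

definition simplicial_chain_group ::
    "nat \<Rightarrow> 'a set \<Rightarrow> ('a \<Rightarrow> 'a \<Rightarrow> bool) \<Rightarrow> ('a list \<Rightarrow>\<^sub>0 int) set monoid" where
  "simplicial_chain_group q X adj =
     free_Abelian_group (ordered_simplices q X adj) Mod orientation_relations q X adj"

text \<open>The map induced by \<^const>\<open>list_boundary\<close> on cosets. The boundary of an orientation
  relation lies in the subgroup of orientation relations one degree lower, so all members of the
  union coincide: the coset of \<open>c\<close> is sent to the coset of the boundary of \<open>c\<close>.\<close>

definition simplicial_boundary ::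
    "nat \<Rightarrow> 'a set \<Rightarrow> ('a \<Rightarrow> 'a \<Rightarrow> bool) \<Rightarrow> ('a list \<Rightarrow>\<^sub>0 int) set \<Rightarrow> ('a list \<Rightarrow>\<^sub>0 int) set" where
  "simplicial_boundary q X adj A =
     (\<Union>c\<in>A. orientation_relations (q - 1) X adj
              #>\<^bsub>free_Abelian_group (ordered_simplices (q - 1) X adj)\<^esub> list_boundary q c)"

definition simplicial_homology ::
    "nat \<Rightarrow> 'a set \<Rightarrow> ('a \<Rightarrow> 'a \<Rightarrow> bool) \<Rightarrow> ('a list \<Rightarrow>\<^sub>0 int) set set monoid" where
  "simplicial_homology q X adj =
     homology_at
       (simplicial_chain_group (Suc q) X adj) (simplicial_boundary (Suc q) X adj)
       (simplicial_chain_group q X adj) (simplicial_boundary q X adj)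
       (simplicial_chain_group (q - 1) X adj)"

section \<open>Singular homology\<close>

text \<open>\<open>\<Delta>\<^sup>q\<close> is the digital image \<open>{..q}\<close> with adjacency \<open>\<noteq>\<close>. A continuous map
  \<open>\<phi> : \<Delta>\<^sup>q \<rightarrow> X\<close> is recorded by its list of values, which determines it on \<open>{..q}\<close>.\<close>

definition singular_simplices :: "nat \<Rightarrow> 'a set \<Rightarrow> ('a \<Rightarrow> 'a \<Rightarrow> bool) \<Rightarrow> 'a list set" where
  "singular_simplices q X adj =
     {map \<phi> [0..<Suc q] | \<phi>. digital_continuous {..q} (\<noteq>) X adj \<phi>}"

definition singular_chain_group ::
    "nat \<Rightarrow> 'a set \<Rightarrow> ('a \<Rightarrow> 'a \<Rightarrow> bool) \<Rightarrow> ('a list \<Rightarrow>\<^sub>0 int) monoid" where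
  "singular_chain_group q X adj = free_Abelian_group (singular_simplices q X adj)"

definition singular_homology ::
    "nat \<Rightarrow> 'a set \<Rightarrow> ('a \<Rightarrow> 'a \<Rightarrow> bool) \<Rightarrow> ('a list \<Rightarrow>\<^sub>0 int) set monoid" where
  "singular_homology q X adj =
     homology_at
       (singular_chain_group (Suc q) X adj) (list_boundary (Suc q))
       (singular_chain_group q X adj) (list_boundary q)
       (singular_chain_group (q - 1) X adj)"

end

theory Submission
  imports Defs
begin

text \<open>Fix a linear order on the points. Sorting a list by successive insertion, with the sign of the
  sorting permutation and value 0 on lists with repetitions, is an idempotent chain map of the
  singular complex into the chains on ordered simplices. Among the latter its kernel is exactly the
  group of orientation relations, so it identifies oriented chains with chains on sorted lists. On
  singular chains it is homotopic to the identity: all lists involved have their vertices in one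
  simplex, so the homotopy can be built by coning off.\<close>

text \<open>Membership in a subgroup given by generators is hard to refute; the equation
  \<open>sort_chain c = 0\<close> decides it, so statements about cosets become equations between
  chains.

  Sorting is defined by insertion rather than through a sorting permutation because strictly sorted
  lists form the standard basis of the exterior algebra on the points: inserting \<open>a\<close> is
  multiplication by \<open>a\<close> from the left, and \<open>aug_boundary\<close> corresponds to
  contraction with the augmentation. Compatibility with the boundary is then the antiderivation
  rule, proved by induction on lists; the behaviour under permutations is derived separately from
  adjacent swaps.

  The homology groups are compared by one map in a single degree, sending a singular chain to the
  class of its sorted form. It suffices that it maps cycles onto cycles and that a cycle bounds
  exactly when its image does. The homotopy serves only this last point. Degree 0 is delicate: there
  the boundary is zero but the augmented boundary is not.\<close>

lemma frag_extend_frag_extend: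
  "frag_extend f (frag_extend g c) = frag_extend (\<lambda>x. frag_extend f (g x)) c"
  using subset_UNIV by (induction c rule: frag_induction) (auto simp: frag_extend_diff)

lemma frag_extend_fun_diff:
  "frag_extend (\<lambda>x. f x - g x) c = frag_extend f c - frag_extend g c"
  using subset_UNIV by (induction c rule: frag_induction) (auto simp: frag_extend_diff)

lemma frag_extend_fun_minus:
  "frag_extend (\<lambda>x. - f x) c = - frag_extend f c"
  using subset_UNIV by (induction c rule: frag_induction) (auto simp: frag_extend_diff)

lemma frag_extend_frag_of: "frag_extend frag_of c = c"
  by (rule frag_expansion [symmetric])

lemma keys_frag_extend_subset:
  assumes "Poly_Mapping.keys c \<subseteq> S" and "\<And>x. x \<in> S \<Longrightarrow> Poly_Mapping.keys (f x) \<subseteq> T"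
  shows "Poly_Mapping.keys (frag_extend f c) \<subseteq> T"
  using keys_frag_extend [of f c] assms by blast

lemma keys_diff_subset:
  "Poly_Mapping.keys a \<subseteq> S \<Longrightarrow> Poly_Mapping.keys b \<subseteq> S \<Longrightarrow> Poly_Mapping.keys (a - b) \<subseteq> S"
  using keys_diff [of a b] by blast

section \<open>The augmented boundary on lists\<close>

text \<open>The cone operator with apex \<open>a\<close> on chains.\<close>

definition frag_cons :: "'a \<Rightarrow> ('a list \<Rightarrow>\<^sub>0 int) \<Rightarrow> ('a list \<Rightarrow>\<^sub>0 int)" where
  "frag_cons a = frag_extend (\<lambda>xs. frag_of (a # xs))"

lemma frag_cons_0 [simp]: "frag_cons a 0 = 0"
  and frag_cons_of [simp]: "frag_cons a (frag_of xs) = frag_of (a # xs)"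
  and frag_cons_diff: "frag_cons a (c - d) = frag_cons a c - frag_cons a d"
  and frag_cons_minus: "frag_cons a (- c) = - frag_cons a c"
  and frag_cons_cmul: "frag_cons a (frag_cmul k c) = frag_cmul k (frag_cons a c)"
  by (simp_all add: frag_cons_def frag_extend_diff frag_extend_minus frag_extend_cmul)

lemma frag_extend_frag_cons:
  "frag_extend f (frag_cons a c) = frag_extend (\<lambda>xs. f (a # xs)) c"
  by (simp add: frag_cons_def frag_extend_frag_extend)

lemma frag_cons_frag_extend:
  "frag_cons a (frag_extend f c) = frag_extend (\<lambda>xs. frag_cons a (f xs)) c"
  by (simp add: frag_cons_def frag_extend_frag_extend)

text \<open>Equality and not just inclusion: \<open>tl\<close> undoes the cone, so keys can neither
  merge nor cancel.\<close>

lemma keys_frag_cons: "Poly_Mapping.keys (frag_cons a c) = (#) a ` Poly_Mapping.keys c"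
proof
  show "Poly_Mapping.keys (frag_cons a c) \<subseteq> (#) a ` Poly_Mapping.keys c"
    unfolding frag_cons_def by (rule keys_frag_extend_subset [OF subset_refl]) auto
  have "c = frag_extend (\<lambda>xs. frag_of (tl xs)) (frag_cons a c)"
    by (simp add: frag_extend_frag_cons frag_extend_frag_of)
  then have "Poly_Mapping.keys c \<subseteq> tl ` Poly_Mapping.keys (frag_cons a c)"
    using keys_frag_extend [of "\<lambda>xs. frag_of (tl xs)" "frag_cons a c"] by fastforce
  with \<open>Poly_Mapping.keys (frag_cons a c) \<subseteq> (#) a ` Poly_Mapping.keys c\<close>
  show "(#) a ` Poly_Mapping.keys c \<subseteq> Poly_Mapping.keys (frag_cons a c)"
    by fastforce
qed

text \<open>The augmentation in degree 0 is what makes the cone formula hold in all degrees.\<close>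

primrec aug_boundary :: "'a list \<Rightarrow> ('a list \<Rightarrow>\<^sub>0 int)" where
  "aug_boundary [] = 0"
| "aug_boundary (a # xs) = frag_of xs - frag_cons a (aug_boundary xs)"

text \<open>Face 0 drops the head; every later face is the cone over a face of the tail, with its
  index shifted by one and hence its sign reversed.\<close>

lemma sum_list_faces_eq_aug_boundary:
  "length xs = n \<Longrightarrow>
    (\<Sum>i<n. frag_cmul ((-1) ^ i) (frag_of (list_face i xs))) = aug_boundary xs"
proof (induction xs arbitrary: n)
  case (Cons a xs)
  then obtain m where n: "n = Suc m" "length xs = m" by auto
  have "frag_cmul ((-1) ^ Suc i) (frag_of (list_face (Suc i) (a # xs)))
      = - frag_cons a (frag_cmul ((-1) ^ i) (frag_of (list_face i xs)))" for i
    by (simp add: list_face_def frag_cons_cmul)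
  then have "(\<Sum>i<n. frag_cmul ((-1) ^ i) (frag_of (list_face i (a # xs))))
      = frag_of xs + (\<Sum>i<m. - frag_cons a (frag_cmul ((-1) ^ i) (frag_of (list_face i xs))))"
    unfolding n by (subst sum.lessThan_Suc_shift) (simp add: list_face_def)
  also have "\<dots> = frag_of xs - frag_cons a (\<Sum>i<m. frag_cmul ((-1) ^ i) (frag_of (list_face i xs)))"
    by (simp add: sum_negf frag_cons_def frag_extend_sum)
  finally show ?case
    using Cons.IH [OF n(2)] by simp
qed auto

text \<open>In degree 0 the two differ: \<open>aug_boundary [x]\<close> is
  \<open>frag_of []\<close>, whereas \<open>list_boundary\<close> vanishes. The length condition
  matches the range \<open>i \<le> q\<close> of the face sum.\<close>

lemma list_boundary_eq_aug_boundary: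
  assumes "Poly_Mapping.keys c \<subseteq> {xs. length xs = Suc q}" "q > 0"
  shows "list_boundary q c = frag_extend aug_boundary c"
  using assms sum_list_faces_eq_aug_boundary [of _ "Suc q"]
  by (auto simp: list_boundary_def lessThan_Suc_atMost intro!: frag_extend_eq)

text \<open>In particular, a cycle is the boundary of its cone.\<close>

lemma aug_boundary_frag_cons:
  "frag_extend aug_boundary (frag_cons a c) = c - frag_cons a (frag_extend aug_boundary c)"
  by (simp add: frag_extend_frag_cons frag_cons_frag_extend frag_extend_fun_diff frag_extend_frag_of)

text \<open>The cone formula makes the terms cancel by induction, so no double sum over pairs of
  faces arises.\<close>

lemma aug_boundary_aug_boundary: "frag_extend aug_boundary (aug_boundary xs) = 0"
  by (induction xs) (simp_all add: frag_extend_diff aug_boundary_frag_cons)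

lemma keys_aug_boundary:
  "Poly_Mapping.keys (aug_boundary xs) \<subseteq> {ys. Suc (length ys) = length xs \<and> set ys \<subseteq> set xs}"
proof (induction xs)
  case (Cons a xs)
  then have "Poly_Mapping.keys (frag_cons a (aug_boundary xs))
      \<subseteq> {ys. Suc (length ys) = length (a # xs) \<and> set ys \<subseteq> set (a # xs)}"
    unfolding keys_frag_cons by fastforce
  then show ?case
    unfolding aug_boundary.simps by (intro keys_diff_subset) auto
qed simp

section \<open>Signed sorting\<close>

context linorder
begin

primrec signed_insert :: "'a \<Rightarrow> 'a list \<Rightarrow> ('a list \<Rightarrow>\<^sub>0 int)" where
  "signed_insert a [] = frag_of [a]"
| "signed_insert a (b # ys) =
    (if a < b then frag_of (a # b # ys)
     else if a = b then 0
     else - frag_cons b (signed_insert a ys))"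

primrec signed_sort :: "'a list \<Rightarrow> ('a list \<Rightarrow>\<^sub>0 int)" where
  "signed_sort [] = frag_of []"
| "signed_sort (a # xs) = frag_extend (signed_insert a) (signed_sort xs)"

lemma keys_signed_insert:
  "sorted_wrt (<) ys \<Longrightarrow> Poly_Mapping.keys (signed_insert a ys) \<subseteq>
    {zs. length zs = Suc (length ys) \<and> set zs = insert a (set ys) \<and> sorted_wrt (<) zs}"
proof (induction ys)
  case (Cons b ys)
  show ?case
  proof (cases a b rule: linorder_cases)
    case less
    then show ?thesis
      using Cons.prems by auto
  next
    case equal
    then show ?thesis by simp
  next
    case greater
    have "Poly_Mapping.keys (signed_insert a ys) \<subseteq>
      {zs. length zs = Suc (length ys) \<and> set zs = insert a (set ys) \<and> sorted_wrt (<) zs}"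
      using Cons by simp
    then have "(#) b ` Poly_Mapping.keys (signed_insert a ys) \<subseteq> (#) b `
      {zs. length zs = Suc (length ys) \<and> set zs = insert a (set ys) \<and> sorted_wrt (<) zs}"
      by (rule image_mono)
    then show ?thesis
      using greater Cons.prems by (auto simp: keys_frag_cons)
  qed
qed simp

text \<open>Strictly sorted lists are distinct, so keeping both length and vertex set forces the
  value 0 on lists with repetitions.\<close>

lemma keys_signed_sort:
  "Poly_Mapping.keys (signed_sort xs) \<subseteq>
    {zs. length zs = length xs \<and> set zs = set xs \<and> sorted_wrt (<) zs}"
proof (induction xs)
  case (Cons a xs)
  show ?case
    unfolding signed_sort.simps
    by (rule keys_frag_extend_subset [OF Cons.IH]) (use keys_signed_insert in fastforce)
qed simp

lemma signed_insert_less_all: "\<forall>y\<in>set ys. a < y \<Longrightarrow> signed_insert a ys = frag_of (a # ys)"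
  by (cases ys) auto

lemma signed_sort_sorted: "sorted_wrt (<) xs \<Longrightarrow> signed_sort xs = frag_of xs"
  by (induction xs) (auto simp: signed_insert_less_all)

lemma signed_sort_idem:
  "frag_extend signed_sort (signed_sort xs) = signed_sort xs"
proof -
  have "frag_extend signed_sort (signed_sort xs) = frag_extend frag_of (signed_sort xs)"
    by (rule frag_extend_eq) (use keys_signed_sort signed_sort_sorted in blast)
  then show ?thesis
    by (simp add: frag_extend_frag_of)
qed

lemma signed_insert_frag_cons:
  "frag_extend (signed_insert a) (frag_cons b c) =
    (if a < b then frag_cons a (frag_cons b c)
     else if a = b then 0
     else - frag_cons b (frag_extend (signed_insert a) c))"
  by (auto simp: frag_extend_frag_cons frag_cons_frag_extend frag_extend_fun_minus
      intro: frag_extend_eq_0) (simp add: frag_cons_def frag_extend_frag_extend)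

text \<open>Anticommutation of exterior multiplication. Every position of \<open>a\<close> and
  \<open>b\<close> relative to the head \<open>c\<close> is settled directly, except when both
  exceed \<open>c\<close>: then both pass it, the two signs cancel, and the induction hypothesis
  applies under the cone.\<close>

lemma signed_insert_anticommute:
  "frag_extend (signed_insert a) (signed_insert b ys) =
    - frag_extend (signed_insert b) (signed_insert a ys)"
proof (induction ys)
  case Nil
  show ?case by (cases a b rule: linorder_cases) auto
next
  case (Cons c ys)
  have "frag_cons c (frag_extend (signed_insert a) (signed_insert b ys)) =
      - frag_cons c (frag_extend (signed_insert b) (signed_insert a ys))"
    by (subst Cons.IH) (rule frag_cons_minus)
  then show ?case
    by (cases a b rule: linorder_cases; cases a c rule: linorder_cases;
        cases b c rule: linorder_cases)
      (auto simp: signed_insert_frag_cons frag_extend_minus frag_cons_minus)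
qed

text \<open>Insertion works from the right end, so the swap produces its sign before the entries of
  \<open>us\<close> are inserted, and these act linearly.\<close>

lemma signed_sort_swap:
  "signed_sort (us @ a # b # vs) = - signed_sort (us @ b # a # vs)"
proof (induction us)
  case Nil
  show ?case
    by (simp add: frag_extend_frag_extend signed_insert_anticommute [of a b]
        frag_extend_fun_minus)
qed (simp add: frag_extend_minus)

lemma permute_list_adj_transpose:
  assumes "Suc i < length xs"
  shows "permute_list (transpose i (Suc i)) xs =
    take i xs @ xs ! Suc i # xs ! i # drop (Suc (Suc i)) xs"
proof (rule nth_equalityI)
  fix j assume "j < length (permute_list (transpose i (Suc i)) xs)"
  then show "permute_list (transpose i (Suc i)) xs ! j =
    (take i xs @ xs ! Suc i # xs ! i # drop (Suc (Suc i)) xs) ! j"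
    using assms
    by (auto simp: permute_list_def nth_append nth_Cons transpose_def min_def
        split: nat.splits intro: arg_cong [of _ _ "nth xs"])
qed (use assms in auto)

lemma signed_sort_permute_adj:
  assumes "Suc i < length xs"
  shows "signed_sort (permute_list (transpose i (Suc i)) xs) = - signed_sort xs"
proof -
  have "xs = take i xs @ xs ! i # xs ! Suc i # drop (Suc (Suc i)) xs"
    using assms by (metis Cons_nth_drop_Suc Suc_lessD append_take_drop_id)
  then show ?thesis
    unfolding permute_list_adj_transpose [OF assms] by (metis signed_sort_swap)
qed

text \<open>Permuting by \<open>f \<circ> g\<close> permutes by \<open>f\<close> and then by
  \<open>g\<close>, so the law for \<open>g\<close> is applied to an already permuted list; hence
  the quantification over all lists of length \<open>n\<close>.\<close>

lemma signed_sort_permute_compose: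
  assumes "f permutes {..<n}" "g permutes {..<n}"
    and "\<And>xs. length xs = n \<Longrightarrow> signed_sort (permute_list f xs) = frag_cmul (sign f) (signed_sort xs)"
    and "\<And>xs. length xs = n \<Longrightarrow> signed_sort (permute_list g xs) = frag_cmul (sign g) (signed_sort xs)"
    and "length xs = n"
  shows "signed_sort (permute_list (f \<circ> g) xs) = frag_cmul (sign (f \<circ> g)) (signed_sort xs)"
proof -
  have "sign (f \<circ> g) = sign f * sign g"
    using assms by (meson finite_lessThan permutes_imp_permutation sign_compose)
  then show ?thesis
    using assms by (simp add: permute_list_compose mult.commute)
qed

text \<open>The swap law covers adjacent transpositions. A transposition is a product of adjacent
  ones, a permutation is a product of transpositions, and signs multiply along.\<close>

lemma signed_sort_permute:
  assumes "p permutes {..<length xs}"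
  shows "signed_sort (permute_list p xs) = frag_cmul (sign p) (signed_sort xs)"
proof -
  define n where "n = length xs"
  have adj: "signed_sort (permute_list (apply_adj_transps l) xs)
      = frag_cmul (sign (apply_adj_transps l)) (signed_sort xs)"
    if "\<forall>i\<in>set l. Suc i < n" "length xs = n" for l xs
    using that
  proof (induction l arbitrary: xs)
    case (Cons i l)
    have "signed_sort (permute_list (transpose i (Suc i)) ys)
        = frag_cmul (sign (transpose i (Suc i))) (signed_sort ys)" if "length ys = n" for ys
      using that Cons.prems by (simp add: signed_sort_permute_adj sign_swap_id)
    moreover have "transpose i (Suc i) permutes {..<n}" "apply_adj_transps l permutes {..<n}"
      using Cons.prems by (auto intro!: permutes_swap_id permutes_apply_adj_transps)
    ultimately show ?case
      using signed_sort_permute_compose [of "transpose i (Suc i)" n "apply_adj_transps l" xs] Cons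
      by (simp del: o_apply)
  qed (simp add: sign_id)
  have transp: "signed_sort (permute_list (transpose a b) xs)
      = frag_cmul (sign (transpose a b)) (signed_sort xs)"
    if "a < n" "b < n" "length xs = n" for a b xs
  \<comment> \<open>Here \<open>a\<close> and \<open>b\<close> are positions, compared as natural
    numbers and not in the order of the locale.\<close>
  proof (cases a b rule: linorder_class.linorder_cases)
    case less
    then show ?thesis
      using adj [of "adj_transp_seq a b" xs] that
      by (auto simp: adj_transp_seq_correct set_adj_transp_seq)
  next
    case greater
    then show ?thesis
      using adj [of "adj_transp_seq b a" xs] that
      by (auto simp: adj_transp_seq_correct set_adj_transp_seq transpose_commute)
  qed (simp add: sign_id)
  have "p permutes {..<n}" "finite {..<n}" "length xs = n"
    using assms n_def by auto
  then show ?thesis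
  proof (induction p arbitrary: xs rule: permutes_induct)
    case (swap a b p)
    then show ?case
      by (intro signed_sort_permute_compose [where n = n])
        (auto simp: transp intro: permutes_swap_id)
  qed (simp_all add: sign_id)
qed

text \<open>The antiderivation rule for contraction: insertion obeys the same boundary formula as
  the cone.\<close>

lemma aug_boundary_signed_insert:
  "sorted_wrt (<) ys \<Longrightarrow> frag_extend aug_boundary (signed_insert a ys) =
    frag_of ys - frag_extend (signed_insert a) (aug_boundary ys)"
proof (induction ys)
  case (Cons b ys)
  \<comment> \<open>An element below all vertices is inserted at the front, so insertion is a cone;
    faces add no vertices, so this persists on the boundary.\<close>
  have less_keys: "frag_extend (signed_insert c) (aug_boundary zs) = frag_cons c (aug_boundary zs)"
    if "\<forall>z\<in>set zs. c < z" for c zs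
    unfolding frag_cons_def
  proof (rule frag_extend_eq)
    fix ys assume "ys \<in> Poly_Mapping.keys (aug_boundary zs)"
    then have "set ys \<subseteq> set zs"
      using keys_aug_boundary by blast
    with that show "signed_insert c ys = frag_of (c # ys)"
      by (intro signed_insert_less_all) auto
  qed
  show ?case
  proof (cases a b rule: linorder_cases)
    case less
    then have "\<forall>z\<in>set (b # ys). a < z"
      using Cons.prems by auto
    from less_keys [OF this] less show ?thesis
      by simp
  next
    \<comment> \<open>Inserting a duplicate gives 0. On the right only the face omitting
      \<open>b\<close> survives insertion, and it gives back \<open>b # ys\<close>.\<close>
    case equal
    then show ?thesis
      using Cons.prems
      by (simp add: frag_extend_diff signed_insert_frag_cons signed_insert_less_all)
  next
    case greater
    then show ?thesis
      using Cons
      by (auto simp: frag_extend_diff frag_extend_minus signed_insert_frag_cons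
          aug_boundary_frag_cons frag_cons_diff)
  qed
qed simp

lemma aug_boundary_signed_sort:
  "frag_extend aug_boundary (signed_sort xs) = frag_extend signed_sort (aug_boundary xs)"
proof (induction xs)
  case (Cons a xs)
  have "frag_extend aug_boundary (signed_sort (a # xs))
      = frag_extend (\<lambda>ys. frag_of ys - frag_extend (signed_insert a) (aug_boundary ys)) (signed_sort xs)"
    unfolding signed_sort.simps frag_extend_frag_extend
    by (rule frag_extend_eq) (use keys_signed_sort aug_boundary_signed_insert in blast)
  also have "\<dots> = signed_sort xs
      - frag_extend (signed_insert a) (frag_extend aug_boundary (signed_sort xs))"
    by (simp add: frag_extend_fun_diff frag_extend_frag_of frag_extend_frag_extend)
  also have "\<dots> = frag_extend signed_sort (aug_boundary (a # xs))"
    by (simp add: Cons.IH frag_extend_diff frag_extend_frag_cons frag_extend_frag_extend)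
  finally show ?case .
qed simp

text \<open>Acyclic models: the defect of \<open>sort_homotopy n\<close> is a cycle supported on the vertices of \<open>xs\<close>,
  hence bounded by its cone with apex \<open>hd xs\<close>. The recursion is on the length of the list.\<close>

primrec sort_homotopy :: "nat \<Rightarrow> 'a list \<Rightarrow> ('a list \<Rightarrow>\<^sub>0 int)" where
  "sort_homotopy 0 xs = 0"
| "sort_homotopy (Suc n) xs = frag_cons (hd xs)
    (frag_of xs - signed_sort xs - frag_extend (sort_homotopy n) (aug_boundary xs))"

text \<open>The apex is itself a vertex of \<open>xs\<close>, so coning never leaves the vertex
  set.\<close>

lemma keys_sort_homotopy:
  "length xs = n \<Longrightarrow> Poly_Mapping.keys (sort_homotopy n xs) \<subseteq>
    {ys. length ys = Suc n \<and> set ys \<subseteq> set xs}"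
proof (induction n arbitrary: xs)
  case (Suc n)
  let ?T = "{ys. length ys = Suc n \<and> set ys \<subseteq> set xs}"
  have "Poly_Mapping.keys (frag_of xs) \<subseteq> ?T" "Poly_Mapping.keys (signed_sort xs) \<subseteq> ?T"
    using Suc.prems keys_signed_sort [of xs] by auto
  moreover have "Poly_Mapping.keys (frag_extend (sort_homotopy n) (aug_boundary xs)) \<subseteq> ?T"
    by (rule keys_frag_extend_subset [OF keys_aug_boundary]) (use Suc in fastforce)
  ultimately have "Poly_Mapping.keys (frag_of xs - signed_sort xs
      - frag_extend (sort_homotopy n) (aug_boundary xs)) \<subseteq> ?T"
    by (intro keys_diff_subset)
  moreover have "hd xs \<in> set xs"
    using Suc.prems by (cases xs) auto
  ultimately show ?case
    unfolding sort_homotopy.simps keys_frag_cons by fastforce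
qed simp

lemma sort_homotopy:
  "length xs = Suc n \<Longrightarrow>
    frag_extend aug_boundary (sort_homotopy (Suc n) xs) =
      frag_of xs - signed_sort xs - frag_extend (sort_homotopy n) (aug_boundary xs)"
proof (induction n arbitrary: xs)
  case 0
  then obtain x where "xs = [x]" by (auto simp: length_Suc_conv)
  then show ?case by simp
next
  case (Suc n)
  \<comment> \<open>The induction hypothesis is applied to each face of \<open>xs\<close>; the
    resulting term with two boundaries vanishes, which leaves exactly the boundary of
    \<open>frag_of xs - signed_sort xs\<close>.\<close>
  have "frag_extend aug_boundary (frag_extend (sort_homotopy (Suc n)) (aug_boundary xs))
      = frag_extend (\<lambda>ys. frag_of ys - signed_sort ys - frag_extend (sort_homotopy n) (aug_boundary ys))
          (aug_boundary xs)"
    unfolding frag_extend_frag_extend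
    by (rule frag_extend_eq, rule Suc.IH) (use keys_aug_boundary Suc.prems in fastforce)
  also have "\<dots> = aug_boundary xs - frag_extend signed_sort (aug_boundary xs)
      - frag_extend (sort_homotopy n) (frag_extend aug_boundary (aug_boundary xs))"
    by (simp add: frag_extend_fun_diff frag_extend_frag_of frag_extend_frag_extend)
  finally have "frag_extend aug_boundary
      (frag_of xs - signed_sort xs - frag_extend (sort_homotopy (Suc n)) (aug_boundary xs)) = 0"
    by (simp add: frag_extend_diff aug_boundary_signed_sort aug_boundary_aug_boundary)
  then show ?case
    by (simp only: sort_homotopy.simps(2) [of "Suc n"] aug_boundary_frag_cons frag_cons_0 diff_zero)
qed

end

section \<open>Comparing homology groups\<close>

text \<open>The map \<open>f\<close> lives in one degree only. Followed by the projection modulo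
  boundaries it is onto by \<open>cycles\<close> and has the boundaries as kernel by
  \<open>boundaries\<close>, so the first isomorphism theorem applies; the isomorphism is then
  reversed to run from \<open>K\<close> to \<open>G\<close>.\<close>

lemma homology_at_iso:
  assumes G: "comm_group G" and K: "comm_group K"
    and "group G'" "group K'" "group G''" "group K''"
    and d': "d' \<in> hom G' G" and d: "d \<in> hom G G''"
    and e': "e' \<in> hom K' K" and e: "e \<in> hom K K''"
    and dd: "\<And>x. x \<in> carrier G' \<Longrightarrow> d (d' x) = \<one>\<^bsub>G''\<^esub>"
    and ee: "\<And>x. x \<in> carrier K' \<Longrightarrow> e (e' x) = \<one>\<^bsub>K''\<^esub>"
    and f: "f \<in> hom G K"
    and cycles: "f ` kernel G G'' d = kernel K K'' e"
    and boundaries: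
      "\<And>c. c \<in> kernel G G'' d \<Longrightarrow> f c \<in> e' ` carrier K' \<longleftrightarrow> c \<in> d' ` carrier G'"
  shows "homology_at K' e' K e K'' \<cong> homology_at G' d' G d G''"
proof -
  define Z where "Z = G\<lparr>carrier := kernel G G'' d\<rparr>"
  define Y where "Y = K\<lparr>carrier := kernel K K'' e\<rparr>"
  define B where "B = e' ` carrier K'"
  interpret G: comm_group G by fact
  interpret K: comm_group K by fact
  interpret dh: group_hom G G'' d
    using assms by (simp add: group_hom_def group_hom_axioms_def)
  interpret eh: group_hom K K'' e
    using assms by (simp add: group_hom_def group_hom_axioms_def)
  interpret eh': group_hom K' K e'
    using assms by (simp add: group_hom_def group_hom_axioms_def)
  have Z: "group Z"
    unfolding Z_def by (rule subgroup.subgroup_is_group [OF dh.subgroup_kernel G.is_group])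
  have Y: "comm_group Y"
  proof (rule group.group_comm_groupI)
    show "group Y"
      unfolding Y_def by (rule subgroup.subgroup_is_group [OF eh.subgroup_kernel K.is_group])
  qed (auto simp: Y_def kernel_def K.m_comm)
  have "B \<subseteq> kernel K K'' e"
    unfolding B_def kernel_def using ee by auto
  then have BY: "subgroup B Y"
    unfolding Y_def B_def
    by (intro K.subgroup_incl eh'.img_is_subgroup eh.subgroup_kernel)
  then have B: "B \<lhd> Y"
    using Y by (simp add: comm_group.normal_iff_subgroup)
  define \<theta> where "\<theta> = (\<lambda>c. B #>\<^bsub>Y\<^esub> f c)"
  have fZ: "f \<in> hom Z Y"
    using f cycles by (auto simp: hom_def Z_def Y_def kernel_def)
  have \<theta>: "\<theta> \<in> hom Z (Y Mod B)"
    using hom_compose [OF fZ normal.r_coset_hom_Mod [OF B]] by (simp add: \<theta>_def comp_def)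
  interpret \<theta>: group_hom Z "Y Mod B" \<theta>
    using Z \<theta> normal.factorgroup_is_group [OF B] by (simp add: group_hom_def group_hom_axioms_def)
  have "\<theta> ` carrier Z = carrier (Y Mod B)"
    using cycles by (auto simp: \<theta>_def carrier_FactGroup Z_def Y_def simp flip: cycles)
  then have "Z Mod kernel Z (Y Mod B) \<theta> \<cong> Y Mod B"
    using \<theta>.FactGroup_iso_set by (auto simp: is_iso_def)
  then have iso: "Y Mod B \<cong> Z Mod kernel Z (Y Mod B) \<theta>"
    by (rule group.iso_sym [OF normal.factorgroup_is_group [OF \<theta>.normal_kernel]])
  have "\<theta> c = B \<longleftrightarrow> c \<in> d' ` carrier G'" if "c \<in> carrier Z" for c
  proof -
    have "f c \<in> carrier Y"
      using that fZ by (auto simp: hom_def)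
    then have "\<theta> c = B \<longleftrightarrow> f c \<in> B"
      unfolding \<theta>_def using BY Y
      by (metis comm_group.axioms(2) group.coset_join1 group.coset_join2)
    then show ?thesis
      using boundaries that by (simp add: B_def Z_def)
  qed
  \<comment> \<open>The kernel lies in \<open>carrier Z\<close> by definition, so boundaries must be
    known to be cycles before the two sets can agree.\<close>
  moreover have "d' ` carrier G' \<subseteq> carrier Z"
    using dd d' by (auto simp: Z_def kernel_def hom_def)
  ultimately have "kernel Z (Y Mod B) \<theta> = d' ` carrier G'"
    by (auto simp: kernel_def)
  with iso show ?thesis
    by (simp add: homology_at_def Z_def Y_def B_def)
qed

section \<open>Simplices as lists, and the supports of their boundaries\<close>

lemma mem_singular_simplices:
  "xs \<in> singular_simplices q X adj \<longleftrightarrow>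
    length xs = Suc q \<and> set xs \<subseteq> X \<and> (\<forall>x\<in>set xs. \<forall>y\<in>set xs. x = y \<or> adj x y)"
  (is "_ \<longleftrightarrow> ?R")
proof
  assume "xs \<in> singular_simplices q X adj"
  then obtain \<phi> where "xs = map \<phi> [0..<Suc q]" "digital_continuous {..q} (\<noteq>) X adj \<phi>"
    by (auto simp: singular_simplices_def)
  moreover have "set [0..<Suc q] = {..q}"
    by auto
  ultimately show ?R
    by (simp add: digital_continuous_def Pi_iff image_subset_iff del: upt_Suc) metis
next
  assume R: ?R
  have "xs = map ((!) xs) [0..<Suc q]"
    using R by (metis map_nth)
  moreover have "digital_continuous {..q} (\<noteq>) X adj ((!) xs)"
    unfolding digital_continuous_def using R
    by (metis (no_types, lifting) Pi_I atMost_iff less_Suc_eq_le nth_mem subsetD)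
  ultimately show "xs \<in> singular_simplices q X adj"
    unfolding singular_simplices_def by blast
qed

lemma mem_ordered_simplices:
  "xs \<in> ordered_simplices q X adj \<longleftrightarrow> distinct xs \<and> xs \<in> singular_simplices q X adj"
  unfolding mem_singular_simplices
  by (auto simp: ordered_simplices_def simplex_def pairwise_def distinct_card)

text \<open>Singular simplices may repeat points, so any list over the same vertices qualifies, in
  any dimension. Cones whose apex is already a vertex rely on this.\<close>

lemma singular_simplices_subset:
  assumes "xs \<in> singular_simplices q X adj" "set ys \<subseteq> set xs" "length ys = Suc p"
  shows "ys \<in> singular_simplices p X adj"
  using assms unfolding mem_singular_simplices by blast

lemma list_face_in_ordered_simplices:
  assumes "xs \<in> ordered_simplices (Suc q) X adj" "i \<le> Suc q"
  shows "list_face i xs \<in> ordered_simplices q X adj"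
proof -
  have "length xs = Suc (Suc q)" "distinct xs"
    using assms by (auto simp: ordered_simplices_def)
  then have "set (list_face i xs) \<subseteq> set xs" "length (list_face i xs) = Suc q"
    "distinct (list_face i xs)"
    using assms(2)
    by (auto simp: list_face_def dest: in_set_takeD in_set_dropD
        set_take_disj_set_drop_if_distinct [of xs i "Suc i"])
  then show ?thesis
    using assms singular_simplices_subset by (auto simp: mem_ordered_simplices)
qed

text \<open>\<open>keys_aug_boundary\<close> does not record distinctness, so the explicit face sum
  is used here.\<close>

lemma keys_list_boundary_ordered:
  assumes "Poly_Mapping.keys c \<subseteq> ordered_simplices q X adj"
  shows "Poly_Mapping.keys (list_boundary q c) \<subseteq> ordered_simplices (q - 1) X adj"
proof (cases q)
  case (Suc p)
  have "Poly_Mapping.keys (\<Sum>i\<le>q. frag_cmul ((-1) ^ i) (frag_of (list_face i xs)))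
      \<subseteq> ordered_simplices p X adj" if "xs \<in> ordered_simplices q X adj" for xs
    by (rule order_trans [OF keys_sum]) (use that Suc list_face_in_ordered_simplices in fastforce)
  then show ?thesis
    using assms Suc by (auto simp: list_boundary_def dest!: subsetD [OF keys_frag_extend])
qed (simp add: list_boundary_def)

lemma keys_list_boundary_singular:
  assumes "Poly_Mapping.keys c \<subseteq> singular_simplices q X adj"
  shows "Poly_Mapping.keys (list_boundary q c) \<subseteq> singular_simplices (q - 1) X adj"
proof (cases q)
  case (Suc p)
  have "Poly_Mapping.keys (frag_extend aug_boundary c) \<subseteq> singular_simplices p X adj"
  proof (rule keys_frag_extend_subset [OF assms])
    fix xs assume "xs \<in> singular_simplices q X adj"
    then show "Poly_Mapping.keys (aug_boundary xs) \<subseteq> singular_simplices p X adj"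
      using keys_aug_boundary [of xs] Suc singular_simplices_subset [of xs q X adj _ p]
      by (fastforce simp: mem_singular_simplices)
  qed
  then show ?thesis
    using assms Suc by (subst list_boundary_eq_aug_boundary) (auto simp: mem_singular_simplices)
qed (simp add: list_boundary_def)

lemma list_boundary_add: "list_boundary q (c + d) = list_boundary q c + list_boundary q d"
  by (simp add: list_boundary_def frag_extend_add)

lemma list_boundary_list_boundary:
  assumes "Poly_Mapping.keys c \<subseteq> {xs. length xs = Suc (Suc q)}"
  shows "list_boundary q (list_boundary (Suc q) c) = 0"
proof (cases "q = 0")
  case False
  have "Poly_Mapping.keys (frag_extend aug_boundary c) \<subseteq> {xs. length xs = Suc q}"
    by (rule keys_frag_extend_subset [OF assms]) (use keys_aug_boundary in fastforce)
  then show ?thesis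
    using assms False
    by (simp add: list_boundary_eq_aug_boundary frag_extend_frag_extend aug_boundary_aug_boundary
        frag_extend_eq_0)
qed (simp add: list_boundary_def)

section \<open>Oriented chains as cosets of the orientation relations\<close>

lemma keys_orientation_relator:
  assumes xs: "xs \<in> ordered_simplices q X adj" and "\<rho> permutes {..q}"
  shows "Poly_Mapping.keys (frag_of xs - frag_cmul (sign \<rho>) (frag_of (permute_list \<rho> xs)))
    \<subseteq> ordered_simplices q X adj"
proof -
  have "\<rho> permutes {..<length xs}"
    using assms by (simp add: ordered_simplices_def lessThan_Suc_atMost)
  then have "permute_list \<rho> xs \<in> ordered_simplices q X adj"
    using xs by (simp add: ordered_simplices_def)
  with xs show ?thesis
    by (intro keys_diff_subset) auto
qed

lemma orientation_relations_subgroup: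
  "subgroup (orientation_relations q X adj) (free_Abelian_group (ordered_simplices q X adj))"
  unfolding orientation_relations_def
  by (rule group.generate_is_subgroup [OF group_free_Abelian_group])
    (use keys_orientation_relator in fastforce)

lemma ordered_subset_singular: "ordered_simplices q X adj \<subseteq> singular_simplices q X adj"
  by (auto simp: mem_ordered_simplices)

abbreviation orientation_class ::
    "nat \<Rightarrow> 'a set \<Rightarrow> ('a \<Rightarrow> 'a \<Rightarrow> bool) \<Rightarrow> ('a list \<Rightarrow>\<^sub>0 int) \<Rightarrow> ('a list \<Rightarrow>\<^sub>0 int) set" where
  "orientation_class q X adj c \<equiv>
    orientation_relations q X adj #>\<^bsub>free_Abelian_group (ordered_simplices q X adj)\<^esub> c"

lemma orientation_relations_normal:
  "orientation_relations q X adj \<lhd> free_Abelian_group (ordered_simplices q X adj)"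
  by (simp add: comm_group.normal_iff_subgroup [OF abelian_free_Abelian_group]
      orientation_relations_subgroup)

lemma carrier_simplicial_chain_group:
  "carrier (simplicial_chain_group q X adj) =
    orientation_class q X adj ` {c. Poly_Mapping.keys c \<subseteq> ordered_simplices q X adj}"
  by (auto simp: simplicial_chain_group_def carrier_FactGroup)

lemma mult_orientation_class:
  assumes "Poly_Mapping.keys c \<subseteq> ordered_simplices q X adj"
    and "Poly_Mapping.keys d \<subseteq> ordered_simplices q X adj"
  shows "orientation_class q X adj c \<otimes>\<^bsub>simplicial_chain_group q X adj\<^esub> orientation_class q X adj d
    = orientation_class q X adj (c + d)"
  using normal.rcos_sum [OF orientation_relations_normal, of c q X adj d] assms
  by (simp add: simplicial_chain_group_def)

lemma simplicial_chain_group_comm_group: "comm_group (simplicial_chain_group q X adj)"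
  unfolding simplicial_chain_group_def
  by (rule comm_group.abelian_FactGroup [OF abelian_free_Abelian_group orientation_relations_subgroup])

lemma list_boundary_hom:
  "list_boundary q \<in> hom (singular_chain_group q X adj) (singular_chain_group (q - 1) X adj)"
  by (rule homI)
    (simp_all add: singular_chain_group_def list_boundary_add keys_list_boundary_singular
      del: One_nat_def)

section \<open>Sorting on chains, and the passage to homology\<close>

context linorder
begin

abbreviation sort_chain :: "('a list \<Rightarrow>\<^sub>0 int) \<Rightarrow> ('a list \<Rightarrow>\<^sub>0 int)" where
  "sort_chain \<equiv> frag_extend signed_sort"

lemma keys_sort_chain:
  assumes "Poly_Mapping.keys c \<subseteq> singular_simplices q X adj"
  shows "Poly_Mapping.keys (sort_chain c) \<subseteq> ordered_simplices q X adj"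
proof (rule keys_frag_extend_subset [OF assms])
  fix xs assume xs: "xs \<in> singular_simplices q X adj"
  show "Poly_Mapping.keys (signed_sort xs) \<subseteq> ordered_simplices q X adj"
  proof
    fix ys assume "ys \<in> Poly_Mapping.keys (signed_sort xs)"
    then have "length ys = length xs" "set ys = set xs" "sorted_wrt (<) ys"
      using keys_signed_sort by blast+
    then show "ys \<in> ordered_simplices q X adj"
      using xs by (simp add: mem_ordered_simplices mem_singular_simplices strict_sorted_iff)
  qed
qed

lemma sort_chain_idem: "sort_chain (sort_chain c) = sort_chain c"
  by (simp add: frag_extend_frag_extend signed_sort_idem)

lemma list_boundary_sort_chain:
  assumes "Poly_Mapping.keys c \<subseteq> singular_simplices q X adj"
  shows "list_boundary q (sort_chain c) = sort_chain (list_boundary q c)"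
proof (cases "q = 0")
  case False
  have "Poly_Mapping.keys (sort_chain c) \<subseteq> {xs. length xs = Suc q}"
    using keys_sort_chain [OF assms] by (auto simp: ordered_simplices_def)
  moreover have "Poly_Mapping.keys c \<subseteq> {xs. length xs = Suc q}"
    using assms by (auto simp: mem_singular_simplices)
  ultimately show ?thesis
    using False
    by (simp add: list_boundary_eq_aug_boundary frag_extend_frag_extend aug_boundary_signed_sort)
qed (simp add: list_boundary_def)

text \<open>On cycles the term of the homotopy identity that contains the boundary of
  \<open>c\<close> drops out, so sorting changes a cycle only by a boundary.\<close>

lemma sort_chain_homotopic:
  assumes c: "Poly_Mapping.keys c \<subseteq> singular_simplices q X adj" and "list_boundary q c = 0"
  obtains h where "Poly_Mapping.keys h \<subseteq> singular_simplices (Suc q) X adj"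
    "list_boundary (Suc q) h = c - sort_chain c"
proof
  let ?h = "frag_extend (sort_homotopy (Suc q)) c"
  show h: "Poly_Mapping.keys ?h \<subseteq> singular_simplices (Suc q) X adj"
  proof (rule keys_frag_extend_subset [OF c])
    fix xs assume "xs \<in> singular_simplices q X adj"
    then show "Poly_Mapping.keys (sort_homotopy (Suc q) xs) \<subseteq> singular_simplices (Suc q) X adj"
      using keys_sort_homotopy [of xs "Suc q"] singular_simplices_subset [of xs q X adj _ "Suc q"]
      by (fastforce simp: mem_singular_simplices)
  qed
  have len: "Poly_Mapping.keys c \<subseteq> {xs. length xs = Suc q}"
    using c by (auto simp: mem_singular_simplices)
  \<comment> \<open>For \<open>q > 0\<close> the chain is also an augmented cycle. For
    \<open>q = 0\<close> its augmented boundary may be nonzero, but \<open>sort_homotopy 0\<close>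
    is zero.\<close>
  have "frag_extend (sort_homotopy q) (frag_extend aug_boundary c) = 0"
  proof (cases "q = 0")
    case False
    then show ?thesis
      using assms(2) list_boundary_eq_aug_boundary [OF len] by simp
  qed (simp add: frag_extend_eq_0)
  moreover have "list_boundary (Suc q) ?h = frag_extend aug_boundary ?h"
    using h by (intro list_boundary_eq_aug_boundary) (auto simp: mem_singular_simplices)
  moreover have "frag_extend aug_boundary ?h = frag_extend
      (\<lambda>xs. frag_of xs - signed_sort xs - frag_extend (sort_homotopy q) (aug_boundary xs)) c"
    unfolding frag_extend_frag_extend
    by (rule frag_extend_eq, rule sort_homotopy) (use len in blast)
  ultimately show "list_boundary (Suc q) ?h = c - sort_chain c"
    by (simp add: frag_extend_fun_diff frag_extend_frag_of frag_extend_frag_extend)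
qed

lemma frag_of_minus_signed_sort_mem:
  assumes xs: "xs \<in> ordered_simplices q X adj"
  shows "frag_of xs - signed_sort xs \<in> orientation_relations q X adj"
proof -
  have "distinct xs" "length xs = Suc q"
    using xs by (auto simp: ordered_simplices_def)
  obtain p where p: "p permutes {..<length xs}" "permute_list p xs = sort xs"
    using mset_eq_permutation [of "sort xs" xs] by auto
  have "frag_of (sort xs) = frag_cmul (sign p) (signed_sort xs)"
    using signed_sort_permute [OF p(1)] p(2) \<open>distinct xs\<close>
    by (simp add: signed_sort_sorted strict_sorted_iff)
  \<comment> \<open>The sign is its own inverse, so it can be moved to the other side.\<close>
  then have "signed_sort xs = frag_cmul (sign p) (frag_of (permute_list p xs))"
    by (simp add: p(2))
  moreover have "p permutes {..q}"
    using p(1) \<open>length xs = Suc q\<close> by (simp add: lessThan_Suc_atMost)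
  ultimately show ?thesis
    unfolding orientation_relations_def using xs by (intro generate.incl) auto
qed

lemma minus_sort_chain_mem:
  assumes "Poly_Mapping.keys c \<subseteq> ordered_simplices q X adj"
  shows "c - sort_chain c \<in> orientation_relations q X adj"
proof -
  interpret R: subgroup "orientation_relations q X adj"
      "free_Abelian_group (ordered_simplices q X adj)"
    by (rule orientation_relations_subgroup)
  have diff_closed: "a - b \<in> orientation_relations q X adj"
    if "a \<in> orientation_relations q X adj" "b \<in> orientation_relations q X adj" for a b
    using R.m_closed [OF that(1) R.m_inv_closed [OF that(2)]] R.mem_carrier [OF that(2)] by simp
  show ?thesis
    using assms
  proof (induction c rule: frag_induction)
    case zero
    then show ?case using R.one_closed by simp
  next
    case (diff a b)
    then show ?case
      using diff_closed [OF diff] by (simp add: frag_extend_diff algebra_simps)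
  qed (simp add: frag_of_minus_signed_sort_mem)
qed

text \<open>The permutation law kills the generators. Conversely, \<open>c - sort_chain c\<close> is
  a combination of relations, and it is \<open>c\<close> itself once
  \<open>sort_chain c = 0\<close>.\<close>

lemma mem_orientation_relations:
  "c \<in> orientation_relations q X adj \<longleftrightarrow>
    Poly_Mapping.keys c \<subseteq> ordered_simplices q X adj \<and> sort_chain c = 0" (is "?L \<longleftrightarrow> ?R")
proof
  assume L: ?L
  then have "Poly_Mapping.keys c \<subseteq> ordered_simplices q X adj"
    using subgroup.mem_carrier [OF orientation_relations_subgroup] by fastforce
  moreover have relator:
    "sort_chain (frag_of xs - frag_cmul (sign \<rho>) (frag_of (permute_list \<rho> xs))) = 0"
    if "xs \<in> ordered_simplices q X adj" "\<rho> permutes {..q}" for xs \<rho>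
    using that signed_sort_permute [of \<rho> xs]
    by (simp add: ordered_simplices_def lessThan_Suc_atMost frag_extend_diff frag_extend_cmul)
  have "sort_chain c = 0"
    using L unfolding orientation_relations_def
  proof (induction rule: generate.induct)
    case (incl c)
    then show ?case using relator by auto
  next
    case (inv c)
    \<comment> \<open>The group inverse is rewritten to negation only for chains supported on the
      ordered simplices.\<close>
    moreover from this have "Poly_Mapping.keys c \<subseteq> ordered_simplices q X adj"
      using keys_orientation_relator by blast
    ultimately show ?case using relator by (auto simp: frag_extend_minus)
  qed (simp_all add: frag_extend_add)
  ultimately show ?R by simp
next
  assume ?R
  then show ?L
    using minus_sort_chain_mem [of c q X adj] by simp
qed

lemma mem_orientation_class:
  assumes "Poly_Mapping.keys c \<subseteq> ordered_simplices q X adj"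
  shows "e \<in> orientation_class q X adj c \<longleftrightarrow>
    Poly_Mapping.keys e \<subseteq> ordered_simplices q X adj \<and> sort_chain e = sort_chain c" (is "_ \<longleftrightarrow> ?R")
proof -
  have "e \<in> orientation_class q X adj c \<longleftrightarrow> e - c \<in> orientation_relations q X adj"
    by (auto simp: r_coset_def algebra_simps intro!: bexI [of _ "e - c"])
  also have "\<dots> \<longleftrightarrow> ?R"
    using assms keys_diff_subset [of e _ c] keys_add [of "e - c" c]
    by (auto simp: mem_orientation_relations frag_extend_diff)
  finally show ?thesis .
qed

lemma orientation_class_eq_iff:
  assumes "Poly_Mapping.keys c \<subseteq> ordered_simplices q X adj"
    and "Poly_Mapping.keys d \<subseteq> ordered_simplices q X adj"
  shows "orientation_class q X adj c = orientation_class q X adj d \<longleftrightarrow> sort_chain c = sort_chain d"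
proof
  assume "orientation_class q X adj c = orientation_class q X adj d"
  then have "c \<in> orientation_class q X adj d"
    using mem_orientation_class [OF assms(1), of c] assms(1) by simp
  then show "sort_chain c = sort_chain d"
    using mem_orientation_class [OF assms(2), of c] by simp
next
  assume "sort_chain c = sort_chain d"
  then show "orientation_class q X adj c = orientation_class q X adj d"
    unfolding set_eq_iff mem_orientation_class [OF assms(1)] mem_orientation_class [OF assms(2)]
    by simp
qed

lemma list_boundary_sort_chain_ordered:
  assumes "Poly_Mapping.keys c \<subseteq> ordered_simplices q X adj"
  shows "list_boundary q (sort_chain c) = sort_chain (list_boundary q c)"
  by (rule list_boundary_sort_chain [where X = X and adj = adj])
    (rule subset_trans [OF assms ordered_subset_singular])

text \<open>Well-definedness on cosets: representatives of one coset have the same sorted form, and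
  sorting commutes with the boundary, so their boundaries have the same sorted form as well.\<close>

lemma simplicial_boundary_class:
  fixes X :: "'a set"
  assumes c: "Poly_Mapping.keys c \<subseteq> ordered_simplices q X adj"
  shows "simplicial_boundary q X adj (orientation_class q X adj c) =
    orientation_class (q - 1) X adj (list_boundary q c)"
proof -
  have "orientation_class (q - 1) X adj (list_boundary q e) =
      orientation_class (q - 1) X adj (list_boundary q c)"
    if "e \<in> orientation_class q X adj c" for e
  proof -
    have e: "Poly_Mapping.keys e \<subseteq> ordered_simplices q X adj" "sort_chain e = sort_chain c"
      using that mem_orientation_class [OF c] by auto
    then have "sort_chain (list_boundary q e) = sort_chain (list_boundary q c)"
      using c by (simp flip: list_boundary_sort_chain_ordered)
    then show ?thesis
      using c e
      by (simp add: orientation_class_eq_iff keys_list_boundary_ordered del: One_nat_def)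
  qed
  moreover have "c \<in> orientation_class q X adj c"
    using mem_orientation_class [OF c] c by simp
  ultimately show ?thesis
    unfolding simplicial_boundary_def by blast
qed

lemma orientation_class_eq_one:
  assumes "Poly_Mapping.keys c \<subseteq> ordered_simplices q X adj"
  shows "orientation_class q X adj c = \<one>\<^bsub>simplicial_chain_group q X adj\<^esub> \<longleftrightarrow> sort_chain c = 0"
proof -
  have "\<one>\<^bsub>simplicial_chain_group q X adj\<^esub> = orientation_class q X adj 0"
    by (simp add: simplicial_chain_group_def r_coset_def)
  then show ?thesis
    using assms orientation_class_eq_iff [of c q X adj 0] by simp
qed

lemma simplicial_boundary_hom:
  fixes X :: "'a set"
  shows
  "simplicial_boundary q X adj \<in>
    hom (simplicial_chain_group q X adj) (simplicial_chain_group (q - 1) X adj)"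
proof (rule homI)
  fix x assume "x \<in> carrier (simplicial_chain_group q X adj)"
  then obtain c where "x = orientation_class q X adj c"
    "Poly_Mapping.keys c \<subseteq> ordered_simplices q X adj"
    by (auto simp: carrier_simplicial_chain_group)
  then show "simplicial_boundary q X adj x \<in> carrier (simplicial_chain_group (q - 1) X adj)"
    by (simp add: carrier_simplicial_chain_group simplicial_boundary_class
        keys_list_boundary_ordered image_eqI del: One_nat_def)
next
  fix x y
  assume "x \<in> carrier (simplicial_chain_group q X adj)" "y \<in> carrier (simplicial_chain_group q X adj)"
  then obtain c d where "x = orientation_class q X adj c" "y = orientation_class q X adj d"
    and cd: "Poly_Mapping.keys c \<subseteq> ordered_simplices q X adj"
      "Poly_Mapping.keys d \<subseteq> ordered_simplices q X adj"
    by (auto simp: carrier_simplicial_chain_group)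
  moreover have "Poly_Mapping.keys (c + d) \<subseteq> ordered_simplices q X adj"
    using cd keys_add [of c d] by blast
  ultimately show "simplicial_boundary q X adj (x \<otimes>\<^bsub>simplicial_chain_group q X adj\<^esub> y) =
      simplicial_boundary q X adj x \<otimes>\<^bsub>simplicial_chain_group (q - 1) X adj\<^esub> simplicial_boundary q X adj y"
    by (simp add: mult_orientation_class simplicial_boundary_class keys_list_boundary_ordered
        list_boundary_add del: One_nat_def)
qed

lemma simplicial_boundary_boundary:
  fixes X :: "'a set"
  assumes "A \<in> carrier (simplicial_chain_group (Suc q) X adj)"
  shows "simplicial_boundary q X adj (simplicial_boundary (Suc q) X adj A) =
    \<one>\<^bsub>simplicial_chain_group (q - 1) X adj\<^esub>"
proof -
  obtain c where c: "A = orientation_class (Suc q) X adj c"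
    "Poly_Mapping.keys c \<subseteq> ordered_simplices (Suc q) X adj"
    using assms by (auto simp: carrier_simplicial_chain_group)
  moreover have "list_boundary q (list_boundary (Suc q) c) = 0"
    using c(2) by (intro list_boundary_list_boundary) (auto simp: ordered_simplices_def)
  moreover have "Poly_Mapping.keys (list_boundary (Suc q) c) \<subseteq> ordered_simplices q X adj"
    using keys_list_boundary_ordered [OF c(2)] by simp
  ultimately show ?thesis
    by (simp add: simplicial_boundary_class orientation_class_eq_one del: One_nat_def)
qed

theorem simplicial_homology_iso_singular_homology:
  fixes X :: "'a set"
  shows "simplicial_homology q X adj \<cong> singular_homology q X adj"
  unfolding simplicial_homology_def singular_homology_def
proof (rule homology_at_iso)
  \<comment> \<open>Lists with repeated points have no orientation class; sorting discards them
    before the class is taken.\<close>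
  define S where "S = (\<lambda>c. orientation_class q X adj (sort_chain c))"
  let ?Z = "kernel (singular_chain_group q X adj) (singular_chain_group (q - 1) X adj) (list_boundary q)"
  let ?Y = "kernel (simplicial_chain_group q X adj) (simplicial_chain_group (q - 1) X adj)
      (simplicial_boundary q X adj)"
  have Z: "c \<in> ?Z \<longleftrightarrow> Poly_Mapping.keys c \<subseteq> singular_simplices q X adj \<and> list_boundary q c = 0" for c
    by (simp add: kernel_def singular_chain_group_def)
  \<comment> \<open>A class is a cycle when the sorted form of its boundary is 0; as sorting is a
    chain map, this says that the sorted representative is a cycle at the level of chains.\<close>
  have Y: "orientation_class q X adj c \<in> ?Y \<longleftrightarrow> list_boundary q (sort_chain c) = 0"
    if "Poly_Mapping.keys c \<subseteq> ordered_simplices q X adj" for c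
    using that
    by (auto simp: kernel_def carrier_simplicial_chain_group simplicial_boundary_class
        orientation_class_eq_one keys_list_boundary_ordered list_boundary_sort_chain_ordered
        simp del: One_nat_def)
  show "S \<in> hom (singular_chain_group q X adj) (simplicial_chain_group q X adj)"
    by (rule homI) (simp_all add: S_def singular_chain_group_def carrier_simplicial_chain_group
        mult_orientation_class keys_sort_chain frag_extend_add)
  show "S ` ?Z = ?Y"
  proof (intro equalityI subsetI)
    fix A assume "A \<in> S ` ?Z"
    then obtain c where c: "A = S c" "Poly_Mapping.keys c \<subseteq> singular_simplices q X adj"
      "list_boundary q c = 0"
      using Z by auto
    then have "list_boundary q (sort_chain (sort_chain c)) = 0"
      by (simp add: sort_chain_idem list_boundary_sort_chain)
    then show "A \<in> ?Y"
      unfolding c(1) S_def Y [OF keys_sort_chain [OF c(2)]] .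
  next
    fix A assume A: "A \<in> ?Y"
    then obtain c where c: "A = orientation_class q X adj c"
      "Poly_Mapping.keys c \<subseteq> ordered_simplices q X adj"
      by (auto simp: kernel_def carrier_simplicial_chain_group)
    have sort_c: "Poly_Mapping.keys (sort_chain c) \<subseteq> ordered_simplices q X adj"
      by (rule keys_sort_chain [OF subset_trans [OF c(2) ordered_subset_singular]])
    moreover have "list_boundary q (sort_chain c) = 0"
      using A unfolding c(1) Y [OF c(2)] .
    \<comment> \<open>The preimage is the sorted representative: it is a cycle of chains, and by
      idempotence \<open>S\<close> sends it back to the class of \<open>c\<close>.\<close>
    ultimately have "sort_chain c \<in> ?Z"
      unfolding Z using ordered_subset_singular [of q X adj] by simp
    moreover have "S (sort_chain c) = A"
      using c sort_c by (simp add: S_def sort_chain_idem orientation_class_eq_iff)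
    ultimately show "A \<in> S ` ?Z"
      by (metis image_eqI)
  qed
  show "S c \<in> simplicial_boundary (Suc q) X adj ` carrier (simplicial_chain_group (Suc q) X adj) \<longleftrightarrow>
      c \<in> list_boundary (Suc q) ` carrier (singular_chain_group (Suc q) X adj)"
    (is "?L \<longleftrightarrow> ?R") if "c \<in> ?Z" for c
  proof
    assume ?L
    then obtain d where d: "Poly_Mapping.keys d \<subseteq> ordered_simplices (Suc q) X adj"
      "S c = orientation_class q X adj (list_boundary (Suc q) d)"
      by (auto simp: carrier_simplicial_chain_group simplicial_boundary_class)
    have c: "Poly_Mapping.keys c \<subseteq> singular_simplices q X adj" "list_boundary q c = 0"
      using that Z by auto
    have sd: "Poly_Mapping.keys d \<subseteq> singular_simplices (Suc q) X adj"
      using d(1) ordered_subset_singular by blast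
    have "sort_chain c = sort_chain (list_boundary (Suc q) d)"
      using d c keys_list_boundary_ordered [OF d(1)]
      by (simp add: S_def orientation_class_eq_iff keys_sort_chain sort_chain_idem)
    also have "\<dots> = list_boundary (Suc q) (sort_chain d)"
      using list_boundary_sort_chain [OF sd] by simp
    finally have sc: "sort_chain c = list_boundary (Suc q) (sort_chain d)" .
    obtain h where h: "Poly_Mapping.keys h \<subseteq> singular_simplices (Suc q) X adj"
      "list_boundary (Suc q) h = c - sort_chain c"
      using sort_chain_homotopic [OF c] by blast
    \<comment> \<open>The chain \<open>sort_chain d\<close> bounds the sorted part of
      \<open>c\<close>, and \<open>h\<close> bounds the difference between \<open>c\<close> and its
      sorted part.\<close>
    have "c = list_boundary (Suc q) (h + sort_chain d)"
      using h sc by (simp add: list_boundary_add)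
    moreover have "Poly_Mapping.keys (h + sort_chain d) \<subseteq> singular_simplices (Suc q) X adj"
      using h(1) keys_sort_chain [OF sd] ordered_subset_singular [of "Suc q" X adj]
        keys_add [of h "sort_chain d"] by blast
    ultimately show ?R
      by (simp add: singular_chain_group_def)
  next
    assume ?R
    then obtain d where d: "Poly_Mapping.keys d \<subseteq> singular_simplices (Suc q) X adj"
      "c = list_boundary (Suc q) d"
      by (auto simp: singular_chain_group_def)
    then have "S c = simplicial_boundary (Suc q) X adj (orientation_class (Suc q) X adj (sort_chain d))"
      by (simp add: S_def simplicial_boundary_class keys_sort_chain list_boundary_sort_chain)
    then show ?L
      using keys_sort_chain [OF d(1)] by (simp add: carrier_simplicial_chain_group)
  qed
next
  fix x assume "x \<in> carrier (singular_chain_group (Suc q) X adj)"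
  then have "Poly_Mapping.keys x \<subseteq> {xs. length xs = Suc (Suc q)}"
    by (auto simp: singular_chain_group_def mem_singular_simplices)
  then show "list_boundary q (list_boundary (Suc q) x) = \<one>\<^bsub>singular_chain_group (q - 1) X adj\<^esub>"
    by (simp add: singular_chain_group_def list_boundary_list_boundary)
next
  show "list_boundary (Suc q) \<in> hom (singular_chain_group (Suc q) X adj) (singular_chain_group q X adj)"
    using list_boundary_hom [of "Suc q"] by simp
  show "simplicial_boundary (Suc q) X adj \<in>
      hom (simplicial_chain_group (Suc q) X adj) (simplicial_chain_group q X adj)"
    using simplicial_boundary_hom [of "Suc q"] by simp
next
  show "simplicial_boundary q X adj \<in>
      hom (simplicial_chain_group q X adj) (simplicial_chain_group (q - 1) X adj)"
    by (rule simplicial_boundary_hom)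
  show "list_boundary q \<in> hom (singular_chain_group q X adj) (singular_chain_group (q - 1) X adj)"
    by (rule list_boundary_hom)
qed (rule simplicial_boundary_boundary simplicial_chain_group_comm_group
    comm_group.axioms(2) [OF simplicial_chain_group_comm_group]
    | assumption | simp add: singular_chain_group_def abelian_free_Abelian_group)+

end

text \<open>The points come without an order; the well-ordering theorem supplies one with which the
  locale can be instantiated.\<close>

lemma exists_linorder: "\<exists>(le :: 'a \<Rightarrow> 'a \<Rightarrow> bool) lt. class.linorder le lt"
proof -
  obtain r :: "'a rel" where r: "Well_order r" "Field r = UNIV"
    using well_ordering by metis
  then have "refl r" "trans r" "antisym r" "total r"
    by (simp_all add: order_on_defs)
  \<comment> \<open>The strict relation is given in the form that the preorder axiom
    prescribes.\<close>
  then have "class.linorder (\<lambda>x y. (x, y) \<in> r) (\<lambda>x y. (x, y) \<in> r \<and> (y, x) \<notin> r)"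
    unfolding class.linorder_def class.order_def class.preorder_def class.linorder_axioms_def
      class.order_axioms_def refl_on_def trans_def antisym_def total_on_def
    by (metis UNIV_I)
  then show ?thesis
    by (intro exI)
qed

theorem theorem38:
  fixes X :: "'a set" and adj :: "'a \<Rightarrow> 'a \<Rightarrow> bool"
  assumes "digital_image X adj"
    and "\<exists>k. \<forall>n>k. \<not> (\<exists>S. simplex n X adj S)"
  shows "\<forall>q. simplicial_homology q X adj \<cong> singular_homology q X adj"
proof -
  obtain le lt :: "'a \<Rightarrow> 'a \<Rightarrow> bool" where "class.linorder le lt"
    using exists_linorder by blast
  then show ?thesis
    by (intro allI) (rule linorder.simplicial_homology_iso_singular_homology)
qed

end
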